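(* Let $G=(V,E)$ be the medial graph of a plane cubic graph and let $\gamma$ be the orientation of $G$ directing the edges of $G$ clockwise around black triangles. Then, choosing an orientation $\alpha$ of $G$ uniformly at random (among all $2^{|E|}$ orientations), the event $\Sigma$ that $\alpha$ agrees with $\gamma$ on an even number of edges and the event $\Gamma$ that $\alpha$ is eulerian have correlation given by $$\mathrm{Bias}(\Sigma\mid\Gamma)=\frac{P(G;3)}{F(G;3)}.$$
   Context: Graphs are finite; loops and parallel edges are permitted. Let $H$ be a graph embedded in an orientable surface (here: a cubic graph embedded in the plane). The medial graph $M(H)$ has one vertex placed on each edge of $H$; vertices $e,f$ of $M(H)$ are joined by an edge for each way of drawing a line joining $e$ and $f$ along incident edges $e,f$ of $H$ without crossing edges of $H$, i.e. there is one edge of $M(H)$ for each corner of $H$ (each pair of edges consecutive in the rotation at a vertex of $H$); in particular two edges can be joined by parallel edges. $M(H)$ is $4$-regular and embedded in the same surface. When $H$ is cubic, each vertex $v$ of $H$ lies in the interior of a triangle of $M(H)$ formed by the three edges of $M(H)$ corresponding to the three corners at $v$; these are the black triangles of $M(H)$, and every edge of $M(H)$ belongs to exactly one of them. The orientation $\gamma$ directs the edges of each black triangle clockwise. An orientation of $G$ is eulerian if each vertex has the same number of incoming and outgoing edges. $P(G;q)$ is the number of proper vertex $q$-colourings of $G$; $F(G;q)$ is the number of nowhere-zero $\mathbb{Z}_q$-flows of $G$ (with respect to any fixed orientation). $\mathrm{Bias}(\Sigma\mid\Gamma)=\mathbb{P}(\Sigma\mid\Gamma)-\mathbb{P}(\overline{\Sigma}\mid\Gamma)$,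 where $\overline{\Sigma}$ is the complement of $\Sigma$. *)

theory Defs
  imports
    "HOL-Probability.Probability"
    "HOL-Number_Theory.Cong"
    "HOL-Combinatorics.Orbits"
    "Graph_Theory.Graph_Theory"
begin

text \<open>
  A graph embedded in an orientable surface is given by its rotation system.  The graph itself is
  a finite bidirected multigraph \<open>H\<close>: its arcs are the darts (half-edges), \<open>arev\<close> is the
  fixed-point-free involution exchanging the two darts of an edge, and \<open>tail H d\<close> is the vertex at
  which \<open>d\<close> is attached.  Thus an edge is a set \<open>{d, arev d}\<close>, a loop contributes two darts at its
  vertex, and \<open>out_degree H v\<close> is the usual degree.  \<open>rot d\<close> is the dart that follows \<open>d\<close> in the
  clockwise order around \<open>tail H d\<close>.
\<close>

locale embedded_graph = fin_digraph H + bidirected_digraph H arev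
  for H :: "('v, 'd) pre_digraph" and arev :: "'d \<Rightarrow> 'd" +
  fixes rot :: "'d \<Rightarrow> 'd"
  assumes rot_permutes: "rot permutes arcs H"
    and rot_cyclic: "\<And>v. v \<in> verts H \<Longrightarrow> out_arcs H v \<noteq> {} \<Longrightarrow> cyclic_on rot (out_arcs H v)"

definition face_boundaries :: "('v, 'd) pre_digraph \<Rightarrow> ('d \<Rightarrow> 'd) \<Rightarrow> ('d \<Rightarrow> 'd) \<Rightarrow> 'd set set" where
  "face_boundaries H arev rot = orbit (rot \<circ> arev) ` arcs H"

text \<open>
  Every connected component of genus \<open>g\<close> satisfies \<open>V - E + F = 2 - 2g\<close>, where an isolated vertex
  has one face that carries no dart.  Summed over the components, the equation below therefore
  says that all of them have genus zero, that is, that the embedding is one in the plane (or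
  sphere).  As \<open>H\<close> is bidirected, \<open>sccs_verts\<close> is the set of its connected components.  The graph
  need not be connected.
\<close>

locale plane_graph = embedded_graph +
  assumes euler_formula:
    "int (card (verts H)) - int (card ((\<lambda>d. {d, arev d}) ` arcs H))
       + (int (card (face_boundaries H arev rot)) + int (card {v \<in> verts H. out_arcs H v = {}}))
     = 2 * int (card (pre_digraph.sccs_verts H))"

definition cubic :: "('v, 'd) pre_digraph \<Rightarrow> bool" where
  "cubic H \<longleftrightarrow> (\<forall>v \<in> verts H. out_degree H v = 3)"

text \<open>
  From here on an undirected multigraph is a \<open>pre_digraph\<close> in which \<open>tail\<close> and \<open>head\<close> merely list
  the two ends of each edge.

  The medial graph has an edge for each corner of \<open>H\<close>.  The corner between \<open>d\<close> and \<open>rot d\<close> is named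
  \<open>d\<close>; the ends of the corresponding edge are listed so that going from the \<open>tail\<close> end to the
  \<open>head\<close> end means going clockwise around the vertex \<open>tail H d\<close> of \<open>H\<close>.
\<close>

definition medial_graph :: "('v, 'd) pre_digraph \<Rightarrow> ('d \<Rightarrow> 'd) \<Rightarrow> ('d \<Rightarrow> 'd) \<Rightarrow> ('d set, 'd) pre_digraph"
  where
  "medial_graph H arev rot =
     \<lparr> verts = (\<lambda>d. {d, arev d}) ` arcs H,
       arcs = arcs H,
       tail = (\<lambda>d. {d, arev d}),
       head = (\<lambda>d. {rot d, arev (rot d)}) \<rparr>"

text \<open>
  An orientation assigns to each edge one of its two directions, \<open>True\<close> being the direction from
  the \<open>tail\<close> end to the \<open>head\<close> end.  A loop has two orientations as well, so that there are
  \<open>2 ^ card (arcs G)\<close> orientations in total.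
\<close>

definition orientations :: "('a, 'e) pre_digraph \<Rightarrow> ('e \<Rightarrow> bool) set" where
  "orientations G = (arcs G \<rightarrow>\<^sub>E UNIV)"

definition orient :: "('a, 'e) pre_digraph \<Rightarrow> ('e \<Rightarrow> bool) \<Rightarrow> ('a, 'e) pre_digraph" where
  "orient G \<alpha> =
     \<lparr> verts = verts G, arcs = arcs G,
       tail = (\<lambda>e. if \<alpha> e then tail G e else head G e),
       head = (\<lambda>e. if \<alpha> e then head G e else tail G e) \<rparr>"

definition eulerian_orientation :: "('a, 'e) pre_digraph \<Rightarrow> ('e \<Rightarrow> bool) \<Rightarrow> bool" where
  "eulerian_orientation G \<alpha> \<longleftrightarrow>
     (\<forall>v \<in> verts G. in_degree (orient G \<alpha>) v = out_degree (orient G \<alpha>) v)"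

definition agreement :: "('a, 'e) pre_digraph \<Rightarrow> ('e \<Rightarrow> bool) \<Rightarrow> ('e \<Rightarrow> bool) \<Rightarrow> 'e set" where
  "agreement G \<alpha> \<beta> = {e \<in> arcs G. \<alpha> e = \<beta> e}"

text \<open>
  The orientation of a medial graph that directs the edges clockwise around black triangles: the
  edge of the corner \<open>d\<close> lies in the black triangle around \<open>tail H d\<close>, and its ends are listed in
  clockwise order around that vertex.
\<close>

definition clockwise_orientation :: "('v, 'd) pre_digraph \<Rightarrow> 'd \<Rightarrow> bool" where
  "clockwise_orientation H = (\<lambda>d \<in> arcs H. True)"

definition num_colourings :: "('a, 'e) pre_digraph \<Rightarrow> nat \<Rightarrow> nat" where
  "num_colourings G q =
     card {c \<in> verts G \<rightarrow>\<^sub>E {..<q}. \<forall>e \<in> arcs G. c (tail G e) \<noteq> c (head G e)}"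

text \<open>
  The elements of \<open>\<int>\<^sub>q\<close> are represented by \<open>0, \<dots>, q - 1\<close>, so that the nonzero ones are
  \<open>1, \<dots>, q - 1\<close>.  The fixed orientation with respect to which flows are taken is the
  one from \<open>tail\<close> to \<open>head\<close>.
\<close>

definition num_nowhere_zero_flows :: "('a, 'e) pre_digraph \<Rightarrow> nat \<Rightarrow> nat" where
  "num_nowhere_zero_flows G q =
     card {f \<in> arcs G \<rightarrow>\<^sub>E {1..<int q}.
             \<forall>v \<in> verts G. [(\<Sum>e \<in> in_arcs G v. f e) = (\<Sum>e \<in> out_arcs G v. f e)] (mod int q)}"

definition bias :: "'a pmf \<Rightarrow> ('a \<Rightarrow> bool) \<Rightarrow> ('a \<Rightarrow> bool) \<Rightarrow> real" where
  "bias p \<Sigma> \<Gamma> =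
     \<P>(\<omega> in measure_pmf p. \<Sigma> \<omega> \<bar> \<Gamma> \<omega>) - \<P>(\<omega> in measure_pmf p. \<not> \<Sigma> \<omega> \<bar> \<Gamma> \<omega>)"

end

theory Submission
  imports Defs
begin

text \<open>
  As \<open>G\<close> is 4-regular, its eulerian orientations are its nowhere-zero \<open>\<int>\<^sub>3\<close>-flows, and counted with sign
  they give the coefficient of \<open>\<Prod>v. x v ^ 2\<close> in the graph polynomial \<open>\<Prod>e. (x (tail e) - x (head e))\<close>.
  Evaluating the polynomial at all choices of third roots of unity extracts this coefficient as a sum over
  the proper 3-colourings of \<open>G\<close>, that is, the 3-edge-colourings of \<open>H\<close>.  Each of them contributes 1,
  because the numbers of vertices of \<open>H\<close> around which the colours appear in clockwise and in anticlockwise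
  order differ by a multiple of 4.  Indeed, in genus 0 a 3-edge-colouring comes from a face colouring by the
  four elements of \<open>\<int>\<^sub>2 \<times> \<int>\<^sub>2\<close>, that is, from a map of the dual triangulation to the boundary of a
  tetrahedron, and that difference is 4 times the degree of the map.
\<close>

section \<open>Flows and face colourings modulo 2\<close>

lemma finite_PiE_filter:
  assumes "finite A"
  shows "finite {g \<in> A \<rightarrow>\<^sub>E (UNIV :: bool set). P g}"
  by (rule finite_subset[of _ "A \<rightarrow>\<^sub>E UNIV"]) (use assms in \<open>auto intro: finite_PiE\<close>)

text \<open>Functions constant on the fibres of \<open>p\<close> correspond to functions on the
  image of \<open>p\<close>. With \<open>p\<close> sending vertices to components or darts to face
  boundaries, this counts 2-colourings of components and of faces.\<close>

lemma card_factor_through: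
  assumes "finite A"
  shows "card {g \<in> A \<rightarrow>\<^sub>E (UNIV :: bool set). \<forall>x\<in>A. \<forall>y\<in>A. p x = p y \<longrightarrow> g x = g y} = 2 ^ card (p ` A)"
proof -
  have "bij_betw (\<lambda>h. \<lambda>x\<in>A. h (p x)) (p ` A \<rightarrow>\<^sub>E (UNIV :: bool set))
          {g \<in> A \<rightarrow>\<^sub>E UNIV. \<forall>x\<in>A. \<forall>y\<in>A. p x = p y \<longrightarrow> g x = g y}"
  proof (intro bij_betw_imageI inj_onI equalityI subsetI)
    fix h h' assume h: "h \<in> p ` A \<rightarrow>\<^sub>E (UNIV :: bool set)" "h' \<in> p ` A \<rightarrow>\<^sub>E (UNIV :: bool set)"
      "(\<lambda>x\<in>A. h (p x)) = (\<lambda>x\<in>A. h' (p x))"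
    have "h y = h' y" if "y \<in> p ` A" for y
      using that fun_cong[OF h(3)] by (metis imageE restrict_apply')
    then show "h = h'" using h by (intro PiE_ext)
  next
    fix g assume g: "g \<in> {g \<in> A \<rightarrow>\<^sub>E (UNIV :: bool set). \<forall>x\<in>A. \<forall>y\<in>A. p x = p y \<longrightarrow> g x = g y}"
    define h where "h = (\<lambda>y\<in>p ` A. g (SOME x. x \<in> A \<and> p x = y))"
    have "h (p x) = g x" if "x \<in> A" for x
    proof -
      have "(SOME z. z \<in> A \<and> p z = p x) \<in> A \<and> p (SOME z. z \<in> A \<and> p z = p x) = p x"
        by (rule someI[where P = "\<lambda>z. z \<in> A \<and> p z = p x" and x = x]) (use that in auto)
      then have "g (SOME z. z \<in> A \<and> p z = p x) = g x" using g that by blast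
      then show ?thesis using that by (simp add: h_def)
    qed
    moreover have "g \<in> A \<rightarrow>\<^sub>E UNIV" using g by simp
    ultimately have "g = (\<lambda>x\<in>A. h (p x))"
      by (intro PiE_ext[of g A "\<lambda>_. UNIV"]) simp_all
    moreover have "h \<in> p ` A \<rightarrow>\<^sub>E UNIV" by (simp add: h_def)
    ultimately show "g \<in> (\<lambda>h. \<lambda>x\<in>A. h (p x)) ` (p ` A \<rightarrow>\<^sub>E (UNIV :: bool set))"
      by blast
  qed auto
  from bij_betw_same_card[OF this] show ?thesis
    using assms by (simp add: card_PiE)
qed

lemma prod_neg_one_power:
  assumes "finite A"
  shows "(\<Prod>x\<in>A. if P x then -1 else 1 :: 'a :: comm_ring_1) = (-1) ^ card {x\<in>A. P x}"
proof -
  have "(\<Prod>x\<in>A. if P x then -1 else 1 :: 'a) = (\<Prod>x\<in>{x\<in>A. P x}. -1)"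
    using assms by (intro prod.mono_neutral_cong_right) auto
  then show ?thesis by simp
qed

lemma prod_if_const:
  assumes "finite A"
  shows "(\<Prod>x\<in>A. if P x then c else 0) = (if \<forall>x\<in>A. P x then c ^ card A else (0 :: 'a :: comm_semiring_1))"
proof (cases "\<forall>x\<in>A. P x")
  case False
  then obtain x where "x \<in> A" "\<not> P x" by blast
  then have "(\<Prod>x\<in>A. if P x then c else 0) = (0 :: 'a)"
    by (intro prod_zero[OF assms] bexI[of _ x]) auto
  then show ?thesis using False by auto
qed simp

lemma sum_if_const:
  assumes "finite A"
  shows "(\<Sum>x\<in>A. if P x then c else 0) = of_nat (card {x\<in>A. P x}) * (c :: 'a :: semiring_1)"
  using assms by (simp flip: sum.inter_filter)

lemma card_le_fibres:
  assumes "finite A" and "\<And>a. a \<in> A \<Longrightarrow> card {b\<in>A. f b = f a} \<le> k"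
  shows "card A \<le> card (f ` A) * k"
proof -
  have "card A = (\<Sum>y\<in>f ` A. card {b\<in>A. f b = y})"
    using sum.image_gen[OF assms(1), of "\<lambda>_. 1 :: nat" f] by simp
  also have "\<dots> \<le> (\<Sum>y\<in>f ` A. k)"
    using assms by (intro sum_mono) auto
  finally show ?thesis by simp
qed

section \<open>Darts grouped into edges\<close>

context bidirected_digraph
begin

abbreviation edge :: "'b \<Rightarrow> 'b set" where
  "edge d \<equiv> {d, arev d}"

abbreviation edges :: "'b set set" where
  "edges \<equiv> edge ` arcs G"

lemma edge_eq_iff: "edge d = edge d' \<longleftrightarrow> d' = d \<or> d' = arev d"
  by (auto simp: doubleton_eq_iff)

lemma edge_eq: "e \<in> edges \<Longrightarrow> d \<in> e \<Longrightarrow> edge d = e"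
  by (auto simp: doubleton_eq_iff)

end

lemma (in comm_monoid_set) edge:
  assumes "bidirected_digraph K arev" and "d \<in> arcs K"
  shows "F h {d, arev d} = h d \<^bold>* h (arev d)"
  using bidirected_digraph.arev_neq[OF assms] by (simp add: commute)

text \<open>The edges are the orbits of the involution \<open>arev\<close> and so partition the
  darts. Working in \<open>comm_monoid_set\<close> gives the rule for sums and products at
  once.\<close>

lemma (in comm_monoid_set) edges:
  assumes "bidirected_digraph K arev" and "finite (arcs K)"
  shows "F h (arcs K) = F (\<lambda>e. F h e) ((\<lambda>d. {d, arev d}) ` arcs K)"
proof -
  interpret bidirected_digraph K arev by fact
  have "\<Union> edges = arcs K" by auto
  moreover have "F h (\<Union> edges) = (F \<circ> F) h edges"
    by (intro Union_disjoint) (auto simp: arev_eq_iff)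
  ultimately show ?thesis by (simp add: comp_def)
qed

context embedded_graph
begin

lemma card_arcs_edges: "card (arcs H) = 2 * card edges"
proof -
  have "card (arcs H) = (\<Sum>e\<in>edges. \<Sum>d\<in>e. 1)"
    using sum.edges[OF bidirected_digraph finite_arcs, of "\<lambda>_. 1 :: nat"] by simp
  also have "\<dots> = (\<Sum>e\<in>edges. 2)"
    by (intro sum.cong refl) (auto dest: arev_neq)
  finally show ?thesis by simp
qed

lemma rot_in_arcs [simp]: "rot d \<in> arcs H \<longleftrightarrow> d \<in> arcs H"
  using rot_permutes by (simp add: permutes_in_image)

lemma rot_out_arcs: "d \<in> arcs H \<Longrightarrow> out_arcs H (tail H d) = orbit rot d"
  using rot_cyclic[of "tail H d"] tail_in_verts[of d] unfolding cyclic_on_alldef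
  by (metis empty_iff in_out_arcs_conv)

lemma tail_rot [simp]: "d \<in> arcs H \<Longrightarrow> tail H (rot d) = tail H d"
  using rot_out_arcs[of d] orbit.base[of rot d] by (metis in_out_arcs_conv)

text \<open>Arcs come in opposite pairs, so strong components are connected components, and equality
  along arcs propagates along paths. The functions counted are therefore those that factor through
  \<open>scc_of\<close>.\<close>

lemma card_locally_constant:
  "card {s \<in> verts H \<rightarrow>\<^sub>E (UNIV :: bool set). \<forall>d\<in>arcs H. s (tail H d) = s (head H d)} = 2 ^ card sccs_verts"
proof -
  have "(\<forall>d\<in>arcs H. s (tail H d) = s (head H d)) \<longleftrightarrow>
      (\<forall>u\<in>verts H. \<forall>v\<in>verts H. scc_of u = scc_of v \<longrightarrow> s u = s v)" for s :: "'v \<Rightarrow> bool"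
  proof (rule iffI; intro ballI impI)
    fix u v assume s: "\<forall>d\<in>arcs H. s (tail H d) = s (head H d)" and v: "v \<in> verts H" "scc_of u = scc_of v"
    have "u \<rightarrow>\<^sup>*\<^bsub>H\<^esub> v"
      using in_scc_of_self[OF v(1)] v(2) by (auto simp: scc_of_def)
    then show "s u = s v"
      by (induction rule: reachable_induct) (use s in \<open>auto simp: arcs_ends_conv\<close>)
  next
    fix d assume s: "\<forall>u\<in>verts H. \<forall>v\<in>verts H. scc_of u = scc_of v \<longrightarrow> s u = s v" and d: "d \<in> arcs H"
    have "tail H d \<rightarrow>\<^sup>*\<^bsub>H\<^esub> head H d"
      using d by (intro reachable_adjI dominatesI[of d]) (auto simp: arc_to_ends_def)
    moreover from this have "head H d \<rightarrow>\<^sup>*\<^bsub>H\<^esub> tail H d"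
      by (rule symmetric_reachable[OF sym_arcs])
    ultimately have "scc_of (tail H d) = scc_of (head H d)"
      by (auto simp: scc_of_def intro: reachable_trans)
    then show "s (tail H d) = s (head H d)"
      using s d by simp
  qed
  then show ?thesis
    using card_factor_through[of "verts H" scc_of] by (simp add: sccs_verts_conv_scc_of)
qed

text \<open>The cycle space of \<open>H\<close> over Z_2. A loop has both of its darts at its
  vertex, so it never affects the parity there.\<close>

definition mod2_flows :: "('d set \<Rightarrow> bool) set" where
  "mod2_flows = {X \<in> edges \<rightarrow>\<^sub>E UNIV. \<forall>v\<in>verts H. even (card {d \<in> out_arcs H v. X (edge d)})}"

text \<open>Double counting of \<open>(-1) ^ (s \<bullet> \<partial>X)\<close>, where \<open>\<partial>X\<close> is the mod-2 boundary of \<open>X\<close>.\<close>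

lemma card_mod2_flows: "card mod2_flows * 2 ^ card (verts H) = 2 ^ (card edges + card sccs_verts)"
proof -
  define wt :: "('d set \<Rightarrow> bool) \<Rightarrow> ('v \<Rightarrow> bool) \<Rightarrow> int"
    where "wt X s = (\<Prod>d\<in>arcs H. if X (edge d) \<and> s (tail H d) then -1 else 1)" for X s
  let ?XX = "edges \<rightarrow>\<^sub>E (UNIV :: bool set)" and ?SS = "verts H \<rightarrow>\<^sub>E (UNIV :: bool set)"
  have fin: "finite edges" "finite ?XX" "finite ?SS" by (auto intro!: finite_PiE)
  have filter: "{X \<in> ?XX. X \<in> mod2_flows} = mod2_flows"
    by (auto simp: mod2_flows_def)
  \<comment> \<open>Summed over \<open>s\<close> first, the weight factors over the vertices. The
    factor at \<open>v\<close> is 1 + 1 or 1 - 1 according to the parity of the degree of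
    \<open>v\<close> in \<open>X\<close>.\<close>
  have "(\<Sum>s\<in>?SS. wt X s) = (if X \<in> mod2_flows then 2 ^ card (verts H) else 0)" if "X \<in> ?XX" for X
  proof -
    have "wt X s = (\<Prod>v\<in>verts H. if s v then (-1) ^ card {d \<in> out_arcs H v. X (edge d)} else 1)" for s
    proof -
      have "wt X s = (\<Prod>v\<in>verts H. \<Prod>d\<in>out_arcs H v. if X (edge d) \<and> s (tail H d) then -1 else 1)"
        unfolding wt_def out_arcs_def by (subst prod.group) auto
      also have "\<dots> = (\<Prod>v\<in>verts H. \<Prod>d\<in>out_arcs H v. if X (edge d) \<and> s v then -1 else 1)"
        by (intro prod.cong) auto
      also have "\<dots> = (\<Prod>v\<in>verts H. if s v then (-1) ^ card {d \<in> out_arcs H v. X (edge d)} else 1)"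
        by (intro prod.cong refl) (simp add: prod_neg_one_power finite_out_arcs del: in_out_arcs_conv)
      finally show ?thesis .
    qed
    then have "(\<Sum>s\<in>?SS. wt X s) =
        (\<Prod>v\<in>verts H. \<Sum>b\<in>UNIV. if b then (-1) ^ card {d \<in> out_arcs H v. X (edge d)} else 1)"
      by (subst prod_sum_PiE) auto
    also have "\<dots> = (\<Prod>v\<in>verts H. if even (card {d \<in> out_arcs H v. X (edge d)}) then 2 else 0)"
      by (intro prod.cong) (auto simp: UNIV_bool)
    also have "\<dots> = (if X \<in> mod2_flows then 2 ^ card (verts H) else 0)"
      using that by (auto simp: mod2_flows_def)
    finally show ?thesis .
  qed
  then have "(\<Sum>X\<in>?XX. \<Sum>s\<in>?SS. wt X s) = int (card mod2_flows) * 2 ^ card (verts H)"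
    using fin filter by (simp add: sum_if_const)
  \<comment> \<open>Summed over \<open>X\<close> first, the weight factors over the edges. The
    factor of an edge is 1 plus the product of the signs of its two ends: 2 if \<open>s\<close>
    agrees there and 0 otherwise.\<close>
  moreover have "(\<Sum>X\<in>?XX. wt X s) = (if \<forall>d\<in>arcs H. s (tail H d) = s (head H d) then 2 ^ card edges else 0)" for s
  proof -
    have "wt X s = (\<Prod>e\<in>edges. if X e then \<Prod>d\<in>e. if s (tail H d) then -1 else 1 else 1)" for X
    proof -
      have "wt X s = (\<Prod>e\<in>edges. \<Prod>d\<in>e. if X (edge d) \<and> s (tail H d) then -1 else 1)"
        unfolding wt_def by (rule prod.edges) auto
      also have "\<dots> = (\<Prod>e\<in>edges. \<Prod>d\<in>e. if X e \<and> s (tail H d) then -1 else 1)"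
        by (intro prod.cong refl) (metis edge_eq)
      also have "\<dots> = (\<Prod>e\<in>edges. if X e then \<Prod>d\<in>e. if s (tail H d) then -1 else 1 else 1)"
        by (intro prod.cong refl) auto
      finally show ?thesis .
    qed
    then have "(\<Sum>X\<in>?XX. wt X s) = (\<Prod>e\<in>edges. \<Sum>b\<in>UNIV. if b then \<Prod>d\<in>e. if s (tail H d) then -1 else 1 else 1)"
      using fin by (subst prod_sum_PiE) auto
    also have "\<dots> = (\<Prod>e\<in>edges. if \<forall>d\<in>e. s (tail H d) = s (head H d) then 2 else 0)"
    proof (intro prod.cong refl)
      fix e assume "e \<in> edges"
      then obtain d where d: "d \<in> arcs H" "e = edge d" by auto
      show "(\<Sum>b\<in>UNIV. if b then \<Prod>d\<in>e. if s (tail H d) then -1 else 1 else 1) =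
          (if \<forall>d\<in>e. s (tail H d) = s (head H d) then 2 else 0 :: int)"
      proof -
        have "(\<Prod>d\<in>e. if s (tail H d) then -1 else 1 :: int) =
            (if s (tail H d) then -1 else 1) * (if s (head H d) then -1 else 1)"
          unfolding d(2) by (subst prod.edge[OF bidirected_digraph d(1)]) (simp add: d(1))
        moreover have "(\<forall>d\<in>e. s (tail H d) = s (head H d)) \<longleftrightarrow> s (tail H d) = s (head H d)"
          using d by auto
        ultimately show ?thesis by (simp add: UNIV_bool)
      qed
    qed
    also have "\<dots> = (if \<forall>d\<in>arcs H. s (tail H d) = s (head H d) then 2 ^ card edges else 0)"
      unfolding prod_if_const[OF fin(1)] by (intro if_cong) auto
    finally show ?thesis .
  qed
  then have "(\<Sum>s\<in>?SS. \<Sum>X\<in>?XX. wt X s) = 2 ^ card edges * 2 ^ card sccs_verts"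
    using fin by (simp only: sum_if_const card_locally_constant) simp
  ultimately have "int (card mod2_flows) * 2 ^ card (verts H) = 2 ^ card edges * 2 ^ card sccs_verts"
    using sum.swap[of wt ?SS ?XX] by simp
  then show ?thesis
    by (intro of_nat_eq_iff[where 'a = int, THEN iffD1]) (simp add: power_add)
qed

lemma face_permutation: "permutation (rot \<circ> arev)"
proof (rule permutation_compose)
  show "permutation rot" "permutation arev"
    using rot_permutes arev_permutes_arcs finite_arcs unfolding permutation_permutes by blast+
qed

text \<open>As \<open>g\<close> is constant on faces, \<open>g (arev d) = g (rot d)\<close>, so the
  darts counted are those where \<open>g\<close> changes from \<open>d\<close> to
  \<open>rot d\<close>. The number of changes along closed cycles is even: in the product of signs,
  each label occurs twice.\<close>

lemma card_mod2_coboundary: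
  fixes g :: "'d \<Rightarrow> bool"
  assumes "v \<in> verts H" and "\<And>d. d \<in> arcs H \<Longrightarrow> g (rot (arev d)) = g d"
  shows "even (card {d \<in> out_arcs H v. g d \<noteq> g (arev d)})"
proof -
  have fin: "finite (out_arcs H v)" ..
  have r: "g (arev d) = g (rot d)" if "d \<in> arcs H" for d
    using assms(2)[of "arev d"] that by simp
  have bij: "bij_betw rot (out_arcs H v) (out_arcs H v)"
  proof (intro bij_betw_imageI)
    show inj: "inj_on rot (out_arcs H v)"
      using permutes_inj[OF rot_permutes] by (rule inj_on_subset) auto
    show "rot ` out_arcs H v = out_arcs H v"
      using inj fin by (intro endo_inj_surj) auto
  qed
  have "(\<Prod>d\<in>out_arcs H v. if g d \<noteq> g (arev d) then -1 else 1 :: int) =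
        (\<Prod>d\<in>out_arcs H v. (if g d then -1 else 1) * (if g (rot d) then -1 else 1))"
    by (intro prod.cong) (auto simp: r)
  also have "\<dots> = (\<Prod>d\<in>out_arcs H v. if g d then -1 else 1) * (\<Prod>d\<in>out_arcs H v. if g (rot d) then -1 else 1)"
    by (rule prod.distrib)
  also have "(\<Prod>d\<in>out_arcs H v. if g (rot d) then -1 else 1 :: int) = (\<Prod>d\<in>out_arcs H v. if g d then -1 else 1)"
    using prod.reindex_bij_betw[OF bij] .
  finally have "(-1 :: int) ^ card {d \<in> out_arcs H v. g d \<noteq> g (arev d)} = 1"
    using fin by (simp add: prod_neg_one_power flip: power_add mult_2)
  then show ?thesis
    by (simp add: minus_one_power_iff split: if_splits)
qed

end

text \<open>
  Face 2-colourings map to mod-2 flows with fibres of size at most 2 to the number of components; by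
  Euler's formula this leaves no room for a flow outside the image.
\<close>

lemma (in plane_graph) face_2_colouring:
  assumes no_isolated: "\<forall>v\<in>verts H. out_arcs H v \<noteq> {}" and X: "X \<in> mod2_flows"
  shows "\<exists>g :: 'b \<Rightarrow> bool. (\<forall>d\<in>arcs H. g (rot (arev d)) = g d) \<and>
    (\<forall>d\<in>arcs H. X (edge d) \<longleftrightarrow> g d \<noteq> g (arev d))"
proof -
  \<comment> \<open>The cycles of \<open>\<phi>\<close> are the face boundaries, so
    \<open>\<Phi>\<close> is the set of face 2-colourings read off at the darts. \<open>T\<close>
    sends a colouring to the set of edges whose two sides are coloured differently.\<close>
  define \<phi> where "\<phi> = rot \<circ> arev"
  define \<Phi> where "\<Phi> = {g \<in> arcs H \<rightarrow>\<^sub>E (UNIV :: bool set). \<forall>x\<in>arcs H. \<forall>y\<in>arcs H. orbit \<phi> x = orbit \<phi> y \<longrightarrow> g x = g y}"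
  define T where "T g = (\<lambda>e\<in>edges. \<exists>d\<in>e. g d \<noteq> g (arev d))" for g :: "'b \<Rightarrow> bool"
  have T: "T g (edge d) \<longleftrightarrow> g d \<noteq> g (arev d)" if "d \<in> arcs H" for g d
    using that by (auto simp: T_def)
  have \<Phi>: "g (rot (arev d)) = g d" if "g \<in> \<Phi>" "d \<in> arcs H" for g d
  proof -
    have "orbit \<phi> (\<phi> d) = orbit \<phi> d"
      unfolding \<phi>_def by (rule permutation_orbit_step[OF face_permutation])
    moreover have "\<phi> d \<in> arcs H" using that by (simp add: \<phi>_def)
    ultimately have "g (\<phi> d) = g d" using that unfolding \<Phi>_def by blast
    then show ?thesis by (simp add: \<phi>_def)
  qed
  have fin: "finite \<Phi>" "finite mod2_flows"
    unfolding \<Phi>_def mod2_flows_def by (intro finite_PiE_filter; simp)+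
  have "T ` \<Phi> \<subseteq> mod2_flows"
  proof safe
    fix g assume g: "g \<in> \<Phi>"
    have "{d \<in> out_arcs H v. T g (edge d)} = {d \<in> out_arcs H v. g d \<noteq> g (arev d)}" for v
      by (intro Collect_cong conj_cong) (auto simp: T simp del: insert_iff)
    then show "T g \<in> mod2_flows"
      using card_mod2_coboundary[of _ g] \<Phi>[OF g] by (auto simp: mod2_flows_def T_def)
  qed
  moreover have "card mod2_flows \<le> card (T ` \<Phi>)"
  proof -
    \<comment> \<open>Two face colourings with the same image under \<open>T\<close> differ by a
      function that is invariant under \<open>rot\<close> and \<open>arev\<close>. It descends to a
      locally constant function on the vertices, which determines the difference.\<close>
    have "card {h\<in>\<Phi>. T h = T g} \<le> 2 ^ card sccs_verts" if g: "g \<in> \<Phi>" for g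
    proof -
      let ?L = "{s \<in> verts H \<rightarrow>\<^sub>E (UNIV :: bool set). \<forall>d\<in>arcs H. s (tail H d) = s (head H d)}"
      define dart where "dart v = (SOME d. d \<in> out_arcs H v)" for v
      define s where "s h = (\<lambda>v\<in>verts H. h (dart v) \<noteq> g (dart v))" for h :: "'b \<Rightarrow> bool"
      have s: "s h (tail H d) \<longleftrightarrow> h d \<noteq> g d" if h: "h \<in> \<Phi>" "T h = T g" and d: "d \<in> arcs H" for h d
      proof -
        have inv: "(h (rot d) \<noteq> g (rot d)) \<longleftrightarrow> (h d \<noteq> g d)" if "d \<in> arcs H" for d
          using \<Phi>[OF g, of "arev d"] \<Phi>[OF h(1), of "arev d"] T[OF that, of g] T[OF that, of h] h(2) that by auto
        have "d' \<in> orbit rot d \<Longrightarrow> d' \<in> arcs H \<and> ((h d' \<noteq> g d') \<longleftrightarrow> (h d \<noteq> g d))" for d'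
          by (induction rule: orbit.induct) (use d inv in auto)
        moreover have "dart (tail H d) \<in> out_arcs H (tail H d)"
          unfolding dart_def by (rule someI[of _ d]) (use d in auto)
        ultimately show ?thesis
          using d rot_out_arcs[OF d] by (auto simp: s_def)
      qed
      have "inj_on s {h\<in>\<Phi>. T h = T g}"
      proof (rule inj_onI)
        fix h h' assume h: "h \<in> {h\<in>\<Phi>. T h = T g}" "h' \<in> {h\<in>\<Phi>. T h = T g}" "s h = s h'"
        have "h d = h' d" if "d \<in> arcs H" for d
          using s[of h d] s[of h' d] h that by auto
        moreover have "h \<in> arcs H \<rightarrow>\<^sub>E UNIV" "h' \<in> arcs H \<rightarrow>\<^sub>E UNIV"
          using h by (simp_all add: \<Phi>_def)
        ultimately show "h = h'" by (intro PiE_ext[of h "arcs H" "\<lambda>_. UNIV"]) simp_all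
      qed
      moreover have "s h \<in> ?L" if h: "h \<in> \<Phi>" "T h = T g" for h
      proof -
        have "s h (tail H d) = s h (head H d)" if d: "d \<in> arcs H" for d
          using s[OF h d] s[OF h arev_in_arcs[OF d]] T[OF d, of g] T[OF d, of h] h(2) d by auto
        then show ?thesis by (auto simp: s_def)
      qed
      ultimately have "card {h\<in>\<Phi>. T h = T g} \<le> card ?L"
        by (intro card_inj_on_le[of s] finite_PiE_filter) auto
      then show ?thesis by (simp only: card_locally_constant)
    qed
    from card_le_fibres[where f = T, OF fin(1) this]
    have le: "card \<Phi> \<le> card (T ` \<Phi>) * 2 ^ card sccs_verts" .
    have "2 ^ card (face_boundaries H arev rot) \<le> card (T ` \<Phi>) * 2 ^ card sccs_verts"
    proof -
      have "card \<Phi> = 2 ^ card (face_boundaries H arev rot)"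
        unfolding \<Phi>_def face_boundaries_def \<phi>_def by (rule card_factor_through) simp
      then show ?thesis using le by simp
    qed
    then have "card mod2_flows * 2 ^ card (verts H) * 2 ^ card (face_boundaries H arev rot) \<le>
        2 ^ (card edges + card sccs_verts) * (card (T ` \<Phi>) * 2 ^ card sccs_verts)"
      unfolding card_mod2_flows by simp
    \<comment> \<open>Without isolated vertices, Euler's formula reads V + F = E + 2c, where c is
      the number of components. Together with the size of the cycle space, it turns the fibre bound
      into the claim that the image of \<open>T\<close> is at least as large as
      \<open>mod2_flows\<close>.\<close>
    moreover have "card {v \<in> verts H. out_arcs H v = {}} = 0"
      using no_isolated by (simp add: card_eq_0_iff)
    then have "card (verts H) + card (face_boundaries H arev rot) = card edges + card sccs_verts + card sccs_verts"
      using euler_formula by linarith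
    then have "(2 :: nat) ^ card (verts H) * 2 ^ card (face_boundaries H arev rot) = 2 ^ (card edges + card sccs_verts) * 2 ^ card sccs_verts"
      by (simp only: flip: power_add)
    ultimately have "(2 ^ (card edges + card sccs_verts) * 2 ^ card sccs_verts) * card mod2_flows
       \<le> (2 ^ (card edges + card sccs_verts) * 2 ^ card sccs_verts) * card (T ` \<Phi>)"
      by (simp only: mult_ac)
    then show ?thesis by simp
  qed
  ultimately have "T ` \<Phi> = mod2_flows"
    using fin by (intro card_seteq)
  then obtain g where "g \<in> \<Phi>" "X = T g" using X by blast
  then show ?thesis using \<Phi> T by (intro exI[of _ g]) simp
qed

section \<open>Eulerian orientations of 4-regular graphs\<close>

definition \<omega> :: complex where
  "\<omega> = cis (2 * pi / 3)"

lemma \<omega>_cube: "\<omega> ^ 3 = 1"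
  by (simp add: \<omega>_def Complex.DeMoivre)

lemma \<omega>_sum: "1 + \<omega> + \<omega>\<^sup>2 = 0"
proof -
  have "\<omega> \<noteq> 1"
    by (simp add: \<omega>_def complex_eq_iff cos_120)
  moreover have "(\<omega> - 1) * (1 + \<omega> + \<omega>\<^sup>2) = 0"
    using \<omega>_cube by (simp add: algebra_simps power2_eq_square power3_eq_cube)
  ultimately show ?thesis by simp
qed

lemma \<omega>_power_mod: "\<omega> ^ n = \<omega> ^ (n mod 3)"
  by (subst div_mult_mod_eq[of n 3, symmetric]) (simp only: power_add power_mult mult.commute[of _ 3] \<omega>_cube, simp)

text \<open>Orthogonality of the characters of Z_3, used to extract the terms whose exponents are
  divisible by 3.\<close>

lemma sum_\<omega>_power: "(\<Sum>k<3. \<omega> ^ (k * n)) = (if n mod 3 = 0 then 3 else 0)"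
proof -
  have "(\<Sum>k<3. \<omega> ^ (k * n)) = 1 + \<omega> ^ n + \<omega> ^ (2 * n)"
    by (simp add: numeral_3_eq_3 numeral_2_eq_2)
  also have "\<dots> = 1 + \<omega> ^ (n mod 3) + (\<omega> ^ (n mod 3))\<^sup>2"
    using \<omega>_power_mod[of n] by (simp add: power_even_eq)
  finally have eq: "(\<Sum>k<3. \<omega> ^ (k * n)) = 1 + \<omega> ^ (n mod 3) + (\<omega> ^ (n mod 3))\<^sup>2" .
  have "\<omega> ^ 4 = \<omega>" using \<omega>_power_mod[of 4] by simp
  moreover have "n mod 3 = 0 \<or> n mod 3 = 1 \<or> n mod 3 = 2" by linarith
  ultimately show ?thesis
    using \<omega>_sum unfolding eq by (elim disjE) (simp_all flip: power_mult add: algebra_simps)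
qed

text \<open>The number \<open>1 - \<omega>\<^sup>2\<close> is \<open>1 - \<omega>\<close> times the
  primitive sixth root of unity \<open>- (\<omega>\<^sup>2)\<close>. The congruence makes
  \<open>n\<close> and \<open>k\<close> equal modulo 6, so the product is the k-th power of
  \<open>(1 - \<omega>)\<^sup>2 * - (\<omega>\<^sup>2)\<close>, which is 3.\<close>

lemma rotation_weight:
  assumes sum: "m + n = 2 * k" and cong: "[int m = int n] (mod 12)"
  shows "(1 - \<omega>) ^ m * (1 - \<omega>\<^sup>2) ^ n = 3 ^ k"
proof -
  have "n mod 6 = k mod 6"
  proof -
    have "[2 * int k = int n + int n] (mod 12)"
      using cong_add[OF cong cong_refl[of "int n"]] sum by (simp flip: of_nat_add)
    then have "12 dvd 2 * (int k - int n)"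
      by (simp add: cong_iff_dvd_diff algebra_simps)
    then have "6 dvd int k - int n" by presburger
    then have "[int k = int n] (mod int 6)" by (simp add: cong_iff_dvd_diff)
    then have "[k = n] (mod 6)" by (simp only: cong_int_iff)
    then show ?thesis by (simp add: cong_def)
  qed
  moreover have "(- (\<omega>\<^sup>2)) ^ 6 = 1"
    using \<omega>_power_mod[of 12] by (simp flip: power_mult)
  then have "(- (\<omega>\<^sup>2)) ^ j = (- (\<omega>\<^sup>2)) ^ (j mod 6)" for j
    by (subst div_mult_mod_eq[of j 6, symmetric]) (simp only: power_add power_mult mult.commute[of _ 6], simp)
  ultimately have n: "(- (\<omega>\<^sup>2)) ^ n = (- (\<omega>\<^sup>2)) ^ k" by metis
  have \<omega>2: "\<omega>\<^sup>2 = - 1 - \<omega>"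
    using \<omega>_sum by (simp add: algebra_simps eq_neg_iff_add_eq_0)
  have "1 - \<omega>\<^sup>2 = (1 - \<omega>) * - (\<omega>\<^sup>2)"
    using \<omega>_cube by (simp add: algebra_simps power2_eq_square power3_eq_cube)
  then have "(1 - \<omega>) ^ m * (1 - \<omega>\<^sup>2) ^ n = (1 - \<omega>) ^ (m + n) * (- (\<omega>\<^sup>2)) ^ n"
    by (simp only: power_mult_distrib power_add mult_ac)
  also have "\<dots> = ((1 - \<omega>)\<^sup>2 * - (\<omega>\<^sup>2)) ^ k"
    unfolding n sum power_mult power_mult_distrib ..
  also have "(1 - \<omega>)\<^sup>2 = - 3 * \<omega>"
    using \<omega>_sum by (simp add: algebra_simps power2_eq_square eq_neg_iff_add_eq_0)
  also have "- 3 * \<omega> * - (\<omega>\<^sup>2) = 3"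
    using \<omega>_cube by (simp add: power2_eq_square power3_eq_cube mult.assoc)
  finally show ?thesis .
qed

section \<open>Balance at a vertex of degree 4\<close>

lemma card_filter_add_card_filter_not: "finite A \<Longrightarrow> card {e \<in> A. P e} + card {e \<in> A. \<not> P e} = card A"
  by (subst card_Un_disjoint[symmetric]) (auto intro!: arg_cong[where f = card])

text \<open>Among 0, ..., 4 only 2 leaves the remainder 2 modulo 3.\<close>

lemma balanced_iff_mod_3:
  fixes a b :: nat
  assumes "a + b = 4"
  shows "a = b \<longleftrightarrow> b mod 3 = 2"
proof -
  have "b \<in> {0, 1, 2, 3, 4}" using assms by auto
  then show ?thesis using assms by auto
qed

text \<open>Here \<open>a\<close> and \<open>b\<close> count incoming edges with flow values 1 and
  2, and \<open>c\<close> and \<open>d\<close> the outgoing ones. As 2 is -1 modulo 3, an edge of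
  value 2 acts as a reversed edge of value 1, so \<open>a + d\<close> and \<open>c + b\<close> are
  the in- and out-degree of an orientation. Their difference is 4 minus twice the latter, which is
  divisible by 3 only when it is 0.\<close>

lemma balanced_iff_cong_3:
  fixes a b c d :: nat
  assumes "(a + d) + (c + b) = 4"
  shows "[int a + 2 * int b = int c + 2 * int d] (mod 3) \<longleftrightarrow> a + d = c + b"
proof -
  have "int a + 2 * int b - (int c + 2 * int d) = 4 - 2 * int (c + b) + 3 * (int b - int d)"
    using assms by simp
  then have "[int a + 2 * int b = int c + 2 * int d] (mod 3) \<longleftrightarrow> 3 dvd 4 - 2 * int (c + b)"
    unfolding cong_iff_dvd_diff by (metis dvd_add_left_iff dvd_triv_left)
  moreover have "3 dvd 4 - 2 * int n \<longleftrightarrow> n = 2" if "n \<le> 4" for n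
  proof -
    have "n \<in> {0, 1, 2, 3, 4}" using that by auto
    then show ?thesis by auto
  qed
  ultimately have "[int a + 2 * int b = int c + 2 * int d] (mod 3) \<longleftrightarrow> c + b = 2"
    using assms by (metis le_add2)
  then show ?thesis using assms by auto
qed

lemma sum_if_one_two:
  assumes "finite A"
  shows "(\<Sum>e\<in>A. if P e then 1 else 2 :: int) = int (card {e\<in>A. P e}) + 2 * int (card {e\<in>A. \<not> P e})"
  using assms by (simp add: sum.If_cases Int_def)

text \<open>The degree is the undirected one, with loops counted twice; the listed directions are
  only a reference for flows and orientations.\<close>

locale four_regular_graph = fin_digraph +
  assumes degree_4: "v \<in> verts G \<Longrightarrow> in_degree G v + out_degree G v = 4"
begin

lemma orient_simps [simp]:
  "verts (orient G \<alpha>) = verts G" "arcs (orient G \<alpha>) = arcs G"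
  "tail (orient G \<alpha>) e = (if \<alpha> e then tail G e else head G e)"
  "head (orient G \<alpha>) e = (if \<alpha> e then head G e else tail G e)"
  by (simp_all add: orient_def)

lemma out_degree_orient:
  "out_degree (orient G \<alpha>) v = card {e \<in> out_arcs G v. \<alpha> e} + card {e \<in> in_arcs G v. \<not> \<alpha> e}"
proof -
  have "out_arcs (orient G \<alpha>) v = {e \<in> out_arcs G v. \<alpha> e} \<union> {e \<in> in_arcs G v. \<not> \<alpha> e}"
    by (auto split: if_splits)
  then show ?thesis
    by (simp only: out_degree_def) (intro card_Un_disjoint, auto intro: finite_subset[OF _ finite_arcs])
qed

lemma in_degree_orient:
  "in_degree (orient G \<alpha>) v = card {e \<in> in_arcs G v. \<alpha> e} + card {e \<in> out_arcs G v. \<not> \<alpha> e}"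
proof -
  have "in_arcs (orient G \<alpha>) v = {e \<in> in_arcs G v. \<alpha> e} \<union> {e \<in> out_arcs G v. \<not> \<alpha> e}"
    by (auto split: if_splits)
  then show ?thesis
    by (simp only: in_degree_def) (intro card_Un_disjoint, auto intro: finite_subset[OF _ finite_arcs])
qed

lemma degree_orient:
  assumes "v \<in> verts G"
  shows "in_degree (orient G \<alpha>) v + out_degree (orient G \<alpha>) v = 4"
  using degree_4[OF assms] card_filter_add_card_filter_not[OF finite_in_arcs, of v \<alpha>] card_filter_add_card_filter_not[OF finite_out_arcs, of v \<alpha>]
  unfolding in_degree_orient out_degree_orient unfolding in_degree_def out_degree_def by linarith

text \<open>This is the form of the eulerian condition that sums over third roots of unity
  detect.\<close>

lemma eulerian_orientation_iff_mod_3: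
  "eulerian_orientation G \<alpha> \<longleftrightarrow> (\<forall>v\<in>verts G. out_degree (orient G \<alpha>) v mod 3 = 2)"
proof -
  have "in_degree (orient G \<alpha>) v = out_degree (orient G \<alpha>) v \<longleftrightarrow> out_degree (orient G \<alpha>) v mod 3 = 2"
    if "v \<in> verts G" for v
    using degree_orient[OF that] by (rule balanced_iff_mod_3)
  then show ?thesis by (simp add: eulerian_orientation_def)
qed

text \<open>Value 1 is read as the reference direction of an edge and value 2, being -1, as the
  opposite one. Conservation modulo 3 is then balance at every vertex.\<close>

lemma num_nowhere_zero_flows_3:
  "num_nowhere_zero_flows G 3 = card {\<alpha> \<in> orientations G. eulerian_orientation G \<alpha>}"
proof -
  define flow where "flow \<alpha> = (\<lambda>e\<in>arcs G. if \<alpha> e then 1 else 2 :: int)" for \<alpha>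
  have iff: "[(\<Sum>e\<in>in_arcs G v. flow \<alpha> e) = (\<Sum>e\<in>out_arcs G v. flow \<alpha> e)] (mod 3) \<longleftrightarrow>
      in_degree (orient G \<alpha>) v = out_degree (orient G \<alpha>) v" if v: "v \<in> verts G" for v \<alpha>
  proof -
    have "(\<Sum>e\<in>in_arcs G v. flow \<alpha> e) = (\<Sum>e\<in>in_arcs G v. if \<alpha> e then 1 else 2)"
      "(\<Sum>e\<in>out_arcs G v. flow \<alpha> e) = (\<Sum>e\<in>out_arcs G v. if \<alpha> e then 1 else 2)"
      by (auto simp: flow_def intro!: sum.cong)
    then show ?thesis
      using degree_orient[OF v, of \<alpha>] finite_in_arcs[of v] finite_out_arcs[of v]
      unfolding in_degree_orient out_degree_orient
      by (simp only: sum_if_one_two balanced_iff_cong_3)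
  qed
  have "bij_betw flow {\<alpha> \<in> orientations G. eulerian_orientation G \<alpha>}
     {f \<in> arcs G \<rightarrow>\<^sub>E {1..<int 3}. \<forall>v \<in> verts G. [(\<Sum>e \<in> in_arcs G v. f e) = (\<Sum>e \<in> out_arcs G v. f e)] (mod int 3)}"
  proof (intro bij_betw_imageI inj_onI equalityI subsetI)
    fix \<alpha> \<beta> assume ab: "\<alpha> \<in> {\<alpha> \<in> orientations G. eulerian_orientation G \<alpha>}"
      "\<beta> \<in> {\<alpha> \<in> orientations G. eulerian_orientation G \<alpha>}" "flow \<alpha> = flow \<beta>"
    have "\<alpha> e = \<beta> e" if "e \<in> arcs G" for e
      using fun_cong[OF ab(3), of e] that by (simp add: flow_def split: if_splits)
    then show "\<alpha> = \<beta>" using ab by (auto simp: orientations_def intro: PiE_ext)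
  next
    fix f assume "f \<in> flow ` {\<alpha> \<in> orientations G. eulerian_orientation G \<alpha>}"
    then obtain \<alpha> where \<alpha>: "f = flow \<alpha>" "eulerian_orientation G \<alpha>" by auto
    have "flow \<alpha> \<in> arcs G \<rightarrow>\<^sub>E {1..<int 3}" by (auto simp: flow_def)
    then show "f \<in> {f \<in> arcs G \<rightarrow>\<^sub>E {1..<int 3}. \<forall>v \<in> verts G. [(\<Sum>e \<in> in_arcs G v. f e) = (\<Sum>e \<in> out_arcs G v. f e)] (mod int 3)}"
      using \<alpha> iff by (auto simp: eulerian_orientation_def)
  next
    fix f assume f: "f \<in> {f \<in> arcs G \<rightarrow>\<^sub>E {1..<int 3}. \<forall>v \<in> verts G. [(\<Sum>e \<in> in_arcs G v. f e) = (\<Sum>e \<in> out_arcs G v. f e)] (mod int 3)}"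
    define \<alpha> where "\<alpha> = (\<lambda>e\<in>arcs G. f e = 1)"
    have "f e = flow \<alpha> e" if "e \<in> arcs G" for e
    proof -
      have "f e \<in> {1..<3}" using f that by auto
      then show ?thesis using that by (auto simp: flow_def \<alpha>_def)
    qed
    then have eq: "f = flow \<alpha>"
      using f by (intro PiE_ext[of f "arcs G" "\<lambda>_. {1..<3}"]) (auto simp: flow_def)
    have "eulerian_orientation G \<alpha>"
      unfolding eulerian_orientation_def
    proof
      fix v assume v: "v \<in> verts G"
      then have "[(\<Sum>e\<in>in_arcs G v. f e) = (\<Sum>e\<in>out_arcs G v. f e)] (mod int 3)"
        using f by blast
      then show "in_degree (orient G \<alpha>) v = out_degree (orient G \<alpha>) v"
        using iff[OF v, of \<alpha>] unfolding eq by simp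
    qed
    moreover have "\<alpha> \<in> orientations G"
      unfolding orientations_def \<alpha>_def by simp
    ultimately show "f \<in> flow ` {\<alpha> \<in> orientations G. eulerian_orientation G \<alpha>}"
      using eq by blast
  qed
  then show ?thesis
    unfolding num_nowhere_zero_flows_def by (rule bij_betw_same_card[symmetric])
qed

text \<open>
  The factor \<open>\<omega> ^ x v\<close> stands for \<open>\<omega> ^ (- 2 * x v)\<close>.  Extracting exponents modulo 3 suffices because all
  exponents are at most 4.
\<close>

lemma sum_eulerian_orientations:
  "(\<Sum>x\<in>verts G \<rightarrow>\<^sub>E {..<3}.
      (\<Prod>e\<in>arcs G. \<omega> ^ x (tail G e) - \<omega> ^ x (head G e)) * (\<Prod>v\<in>verts G. \<omega> ^ x v)) =
   3 ^ card (verts G) *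
     (\<Sum>\<alpha> | \<alpha> \<in> orientations G \<and> eulerian_orientation G \<alpha>. (-1) ^ card {e \<in> arcs G. \<not> \<alpha> e})"
  (is "?lhs = _")
proof -
  let ?X = "verts G \<rightarrow>\<^sub>E {..<3 :: nat}"
  have mod_3: "(n + 1) mod 3 = 0 \<longleftrightarrow> n mod 3 = 2" for n :: nat
    by presburger
  have fin: "finite (orientations G)"
    unfolding orientations_def by (intro finite_PiE) auto
  \<comment> \<open>Multiplying out picks one end of each edge, to be its tail in an orientation;
    picking the \<open>head\<close> end brings a factor -1.\<close>
  have expand: "(\<Prod>e\<in>arcs G. \<omega> ^ x (tail G e) - \<omega> ^ x (head G e)) =
      (\<Sum>\<alpha>\<in>orientations G. (-1) ^ card {e \<in> arcs G. \<not> \<alpha> e} *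
         (\<Prod>v\<in>verts G. \<omega> ^ (x v * out_degree (orient G \<alpha>) v)))" for x :: "'a \<Rightarrow> nat"
  proof -
    have "(\<Prod>e\<in>arcs G. \<omega> ^ x (tail G e) - \<omega> ^ x (head G e)) =
        (\<Prod>e\<in>arcs G. \<Sum>b\<in>UNIV. if b then \<omega> ^ x (tail G e) else - (\<omega> ^ x (head G e)))"
      by (simp add: UNIV_bool)
    also have "\<dots> = (\<Sum>\<alpha>\<in>orientations G. \<Prod>e\<in>arcs G. if \<alpha> e then \<omega> ^ x (tail G e) else - (\<omega> ^ x (head G e)))"
      unfolding orientations_def by (subst prod_sum_PiE) auto
    also have "\<dots> = (\<Sum>\<alpha>\<in>orientations G. (-1) ^ card {e \<in> arcs G. \<not> \<alpha> e} *
         (\<Prod>v\<in>verts G. \<omega> ^ (x v * out_degree (orient G \<alpha>) v)))"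
    proof (intro sum.cong refl)
      fix \<alpha>
      have "(\<Prod>e\<in>arcs G. if \<alpha> e then \<omega> ^ x (tail G e) else - (\<omega> ^ x (head G e))) =
          (\<Prod>e\<in>arcs G. (if \<not> \<alpha> e then -1 else 1) * \<omega> ^ x (tail (orient G \<alpha>) e))"
        by (intro prod.cong) auto
      also have "\<dots> = (\<Prod>e\<in>arcs G. if \<not> \<alpha> e then -1 else 1) * (\<Prod>e\<in>arcs G. \<omega> ^ x (tail (orient G \<alpha>) e))"
        by (rule prod.distrib)
      also have "(\<Prod>e\<in>arcs G. if \<not> \<alpha> e then -1 else 1 :: complex) = (-1) ^ card {e \<in> arcs G. \<not> \<alpha> e}"
        by (rule prod_neg_one_power) simp
      also have "(\<Prod>e\<in>arcs G. \<omega> ^ x (tail (orient G \<alpha>) e)) =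
          (\<Prod>v\<in>verts G. \<Prod>e | e \<in> arcs G \<and> tail (orient G \<alpha>) e = v. \<omega> ^ x (tail (orient G \<alpha>) e))"
        by (rule prod.group[symmetric]) auto
      also have "\<dots> = (\<Prod>v\<in>verts G. \<Prod>e\<in>out_arcs (orient G \<alpha>) v. \<omega> ^ x v)"
        by (intro prod.cong refl) (auto simp: out_arcs_def)
      finally show "(\<Prod>e\<in>arcs G. if \<alpha> e then \<omega> ^ x (tail G e) else - (\<omega> ^ x (head G e))) =
          (-1) ^ card {e \<in> arcs G. \<not> \<alpha> e} * (\<Prod>v\<in>verts G. \<omega> ^ (x v * out_degree (orient G \<alpha>) v))"
        by (simp add: out_degree_def power_mult)
    qed
    finally show ?thesis .
  qed
  have "?lhs = (\<Sum>x\<in>?X. \<Sum>\<alpha>\<in>orientations G. (-1) ^ card {e \<in> arcs G. \<not> \<alpha> e} *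
        (\<Prod>v\<in>verts G. \<omega> ^ (x v * (out_degree (orient G \<alpha>) v + 1))))"
    unfolding expand sum_distrib_right
    by (intro sum.cong refl) (simp add: prod.distrib power_add mult_ac distrib_left)
  also have "\<dots> = (\<Sum>\<alpha>\<in>orientations G. (-1) ^ card {e \<in> arcs G. \<not> \<alpha> e} *
      (\<Sum>x\<in>?X. \<Prod>v\<in>verts G. \<omega> ^ (x v * (out_degree (orient G \<alpha>) v + 1))))"
    by (subst sum.swap) (simp only: sum_distrib_left)
  also have "\<dots> = (\<Sum>\<alpha>\<in>orientations G. if eulerian_orientation G \<alpha>
      then 3 ^ card (verts G) * (-1) ^ card {e \<in> arcs G. \<not> \<alpha> e} else 0)"
  proof (intro sum.cong refl)
    fix \<alpha>
    \<comment> \<open>The sum over \<open>x\<close> factors over the vertices. The extra factor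
      raises each exponent by one, so precisely the out-degrees congruent to 2 modulo 3
      survive.\<close>
    have "(\<Sum>x\<in>?X. \<Prod>v\<in>verts G. \<omega> ^ (x v * (out_degree (orient G \<alpha>) v + 1))) =
        (\<Prod>v\<in>verts G. \<Sum>k<3. \<omega> ^ (k * (out_degree (orient G \<alpha>) v + 1)))"
      by (rule prod_sum_PiE[symmetric]) auto
    also have "\<dots> = (\<Prod>v\<in>verts G. if out_degree (orient G \<alpha>) v mod 3 = 2 then 3 else 0)"
      unfolding sum_\<omega>_power by (intro prod.cong if_cong refl mod_3)
    also have "\<dots> = (if eulerian_orientation G \<alpha> then 3 ^ card (verts G) else 0)"
      by (auto simp: eulerian_orientation_iff_mod_3)
    finally show "(-1) ^ card {e \<in> arcs G. \<not> \<alpha> e} *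
        (\<Sum>x\<in>?X. \<Prod>v\<in>verts G. \<omega> ^ (x v * (out_degree (orient G \<alpha>) v + 1))) =
        (if eulerian_orientation G \<alpha> then 3 ^ card (verts G) * (-1) ^ card {e \<in> arcs G. \<not> \<alpha> e} else 0)"
      by simp
  qed
  also have "\<dots> = (\<Sum>\<alpha> | \<alpha> \<in> orientations G \<and> eulerian_orientation G \<alpha>. 3 ^ card (verts G) * (-1) ^ card {e \<in> arcs G. \<not> \<alpha> e})"
    using fin by (rule sum.inter_filter[symmetric])
  finally show ?thesis by (simp add: sum_distrib_left)
qed

end

lemma sum_of_bool_card:
  assumes "finite A"
  shows "(\<Sum>x\<in>A. of_bool (P x)) = card {x\<in>A. P x}"
  using assms by (simp add: of_bool_def sum_if_const)

section \<open>Maps to the boundary of a tetrahedron\<close>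

text \<open>
  The triangulation is the dual of a cubic embedded graph with darts \<open>A\<close>: \<open>g d\<close> is the label of the face
  to the left of \<open>d\<close>, and \<open>N a b c\<close> counts the corners of triangles labelled \<open>a, b, c\<close> in clockwise order.
  \<open>N_edge\<close> says that the signed number of triangles over a face of the tetrahedron does not change
  across the edge \<open>{a, b}\<close>.
\<close>

locale labelled_triangulation =
  fixes A :: "'d set" and rot rev :: "'d \<Rightarrow> 'd" and g :: "'d \<Rightarrow> 'l :: finite"
  assumes finite_A: "finite A"
    and rot_bij: "bij_betw rot A A" and rev_bij: "bij_betw rev A A"
    and rot_cube: "d \<in> A \<Longrightarrow> rot (rot (rot d)) = d"
    and g_rev: "d \<in> A \<Longrightarrow> g (rev d) = g (rot d)" "d \<in> A \<Longrightarrow> g (rot (rev d)) = g d"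
    and g_distinct: "d \<in> A \<Longrightarrow> g (rot d) \<noteq> g d"
begin

definition N :: "'l \<Rightarrow> 'l \<Rightarrow> 'l \<Rightarrow> nat" where
  "N a b c = (\<Sum>d\<in>A. of_bool (g d = a \<and> g (rot d) = b \<and> g (rot (rot d)) = c))"

lemma rot_in [simp]: "d \<in> A \<Longrightarrow> rot d \<in> A"
  using rot_bij by (auto simp: bij_betw_def)

lemma N_rotate: "N a b c = N b c a"
proof -
  have "N b c a = (\<Sum>d\<in>A. of_bool (g (rot d) = b \<and> g (rot (rot d)) = c \<and> g (rot (rot (rot d))) = a))"
    unfolding N_def by (rule sum.reindex_bij_betw[OF rot_bij, symmetric])
  also have "\<dots> = N a b c"
    unfolding N_def by (intro sum.cong arg_cong[where f = of_bool]) (auto simp: rot_cube)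
  finally show ?thesis by simp
qed

lemma N_edge:
  assumes UNIV: "(UNIV :: 'l set) = {a, b, c, e}" and distinct: "distinct [a, b, c, e]"
  shows "N a b c + N a b e = N b a c + N b a e"
proof -
  \<comment> \<open>There are only four labels, and the three around a triangle are distinct, so
    after \<open>a\<close> and \<open>b\<close> the third is \<open>c\<close> or
    \<open>e\<close>.\<close>
  have sum: "N a b c + N a b e = (\<Sum>d\<in>A. of_bool (g d = a \<and> g (rot d) = b))"
    if UNIV: "(UNIV :: 'l set) = {a, b, c, e}" and distinct: "distinct [a, b, c, e]" for a b c e
    unfolding N_def sum.distrib[symmetric]
  proof (intro sum.cong refl)
    fix d assume d: "d \<in> A"
    have "g (rot (rot d)) \<in> {a, b, c, e}" unfolding UNIV[symmetric] by simp
    moreover have "g (rot (rot d)) \<noteq> g (rot d)" "g (rot (rot d)) \<noteq> g d"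
      using g_distinct[of "rot d"] g_distinct[of "rot (rot d)"] d by (auto simp: rot_cube)
    ultimately show "of_bool (g d = a \<and> g (rot d) = b \<and> g (rot (rot d)) = c) +
        of_bool (g d = a \<and> g (rot d) = b \<and> g (rot (rot d)) = e) = (of_bool (g d = a \<and> g (rot d) = b) :: nat)"
      using distinct by auto
  qed
  \<comment> \<open>A side shared by two triangles is traversed in opposite directions by them, and
    \<open>rev\<close> exchanges the two traversals.\<close>
  have "(\<Sum>d\<in>A. of_bool (g d = b \<and> g (rot d) = a)) = (\<Sum>d\<in>A. of_bool (g (rev d) = b \<and> g (rot (rev d)) = a))"
    by (rule sum.reindex_bij_betw[OF rev_bij, symmetric])
  also have "\<dots> = (\<Sum>d\<in>A. of_bool (g d = a \<and> g (rot d) = b))"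
    by (intro sum.cong arg_cong[where f = of_bool]) (auto simp: g_rev)
  finally show ?thesis
    using sum[of a b c e] sum[of b a c e] UNIV distinct by (auto simp: insert_commute)
qed

end

text \<open>
  The edge colours 0, 1, 2 correspond to the nonzero elements \<open>(0, 1)\<close>, \<open>(1, 0)\<close>, \<open>(1, 1)\<close> of
  \<open>\<int>\<^sub>2 \<times> \<int>\<^sub>2\<close>.  The modulus is 12 rather than 4 since every triangle is counted at its three corners.
\<close>

lemma colour_steps_balanced:
  fixes rot rev :: "'d \<Rightarrow> 'd" and g :: "'d \<Rightarrow> bool \<times> bool" and c :: "'d \<Rightarrow> nat"
  assumes "finite A" "bij_betw rot A A" "bij_betw rev A A"
    and rot_cube: "\<And>d. d \<in> A \<Longrightarrow> rot (rot (rot d)) = d"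
    and "\<And>d. d \<in> A \<Longrightarrow> g (rev d) = g (rot d)" "\<And>d. d \<in> A \<Longrightarrow> g (rot (rev d)) = g d"
    and c: "\<And>d. d \<in> A \<Longrightarrow> c d < 3" "\<And>d. d \<in> A \<Longrightarrow> c (rot d) \<noteq> c d"
    and bits: "\<And>d. d \<in> A \<Longrightarrow> c d \<noteq> 0 \<longleftrightarrow> fst (g d) \<noteq> fst (g (rot d))"
      "\<And>d. d \<in> A \<Longrightarrow> c d \<noteq> 1 \<longleftrightarrow> snd (g d) \<noteq> snd (g (rot d))"
  shows "[int (card {d \<in> A. c (rot d) = (c d + 1) mod 3}) = int (card {d \<in> A. c (rot d) \<noteq> (c d + 1) mod 3})] (mod 12)"
proof -
  interpret labelled_triangulation A rot rev g
  proof
    show "g (rot d) \<noteq> g d" if "d \<in> A" for d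
      using bits[OF that] by force
  qed (use assms in auto)
  define p q r s where "p = (False, False)" and "q = (False, True)" and "r = (True, False)" and "s = (True, True)"
  note pqrs = p_def q_def r_def s_def
  have UNIV: "UNIV = {p, q, r, s}" by (auto simp: pqrs)
  have distinct: "distinct [p, q, r, s]" by (simp add: pqrs)
  \<comment> \<open>By \<open>bits\<close>, the colour \<open>c d\<close> encodes the sum of
    \<open>g d\<close> and \<open>g (rot d)\<close>. The first list holds each of the four faces of
    the tetrahedron in one orientation, with its three rotations; the second holds the opposite
    orientations.\<close>
  have step: "c (rot d) = (c d + 1) mod 3 \<longleftrightarrow>
      (g d, g (rot d), g (rot (rot d))) \<in> {(p,q,s), (q,s,p), (s,p,q), (q,p,r), (p,r,q), (r,q,p),
        (r,s,q), (s,q,r), (q,r,s), (s,r,p), (r,p,s), (p,s,r)}"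
    and step': "c (rot d) \<noteq> (c d + 1) mod 3 \<longleftrightarrow>
      (g d, g (rot d), g (rot (rot d))) \<in> {(p,q,r), (q,r,p), (r,p,q), (q,p,s), (p,s,q), (s,q,p),
        (r,s,p), (s,p,r), (p,r,s), (s,r,q), (r,q,s), (q,s,r)}" if d: "d \<in> A" for d
  proof -
    obtain x1 x2 y1 y2 z1 z2 where g: "g d = (x1, x2)" "g (rot d) = (y1, y2)" "g (rot (rot d)) = (z1, z2)"
      by (metis surj_pair)
    have "c d = 0 \<or> c d = 1 \<or> c d = 2" "c (rot d) = 0 \<or> c (rot d) = 1 \<or> c (rot d) = 2"
      using c(1)[of d] c(1)[of "rot d"] d by auto
    moreover have "c d \<noteq> c (rot d)" using c(2)[OF d] by simp
    moreover have "c d \<noteq> 0 \<longleftrightarrow> x1 \<noteq> y1" "c d \<noteq> 1 \<longleftrightarrow> x2 \<noteq> y2" "c (rot d) \<noteq> 0 \<longleftrightarrow> y1 \<noteq> z1" "c (rot d) \<noteq> 1 \<longleftrightarrow> y2 \<noteq> z2"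
      using bits[of d] bits[of "rot d"] d by (simp_all add: g)
    ultimately show "c (rot d) = (c d + 1) mod 3 \<longleftrightarrow>
      (g d, g (rot d), g (rot (rot d))) \<in> {(p,q,s), (q,s,p), (s,p,q), (q,p,r), (p,r,q), (r,q,p),
        (r,s,q), (s,q,r), (q,r,s), (s,r,p), (r,p,s), (p,s,r)}"
      "c (rot d) \<noteq> (c d + 1) mod 3 \<longleftrightarrow>
      (g d, g (rot d), g (rot (rot d))) \<in> {(p,q,r), (q,r,p), (r,p,q), (q,p,s), (p,s,q), (s,q,p),
        (r,s,p), (s,p,r), (p,r,s), (s,r,q), (r,q,s), (q,s,r)}"
      unfolding g pqrs by (elim disjE; cases x1; cases x2; simp)+
  qed
  have count: "card {d \<in> A. (g d, g (rot d), g (rot (rot d))) \<in> set ts} = (\<Sum>(a, b, c)\<leftarrow>ts. N a b c)" if "distinct ts" for ts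
    using that
  proof (induction ts)
    case (Cons t ts)
    obtain a b c where t: "t = (a, b, c)" by (cases t) auto
    have "card {d \<in> A. (g d, g (rot d), g (rot (rot d))) \<in> set (t # ts)} =
        (\<Sum>d\<in>A. of_bool ((g d, g (rot d), g (rot (rot d))) \<in> set (t # ts)))"
      using finite_A by (rule sum_of_bool_card[symmetric])
    also have "\<dots> = (\<Sum>d\<in>A. of_bool ((g d, g (rot d), g (rot (rot d))) = t) +
        of_bool ((g d, g (rot d), g (rot (rot d))) \<in> set ts))"
      using Cons.prems by (intro sum.cong) auto
    also have "\<dots> = N a b c + card {d \<in> A. (g d, g (rot d), g (rot (rot d))) \<in> set ts}"
      unfolding sum.distrib sum_of_bool_card[OF finite_A, of "\<lambda>d. (g d, g (rot d), g (rot (rot d))) \<in> set ts"]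
      by (simp add: N_def t)
    finally show ?case using Cons by (simp add: t)
  qed simp
  have "{d \<in> A. c (rot d) = (c d + 1) mod 3} =
      {d \<in> A. (g d, g (rot d), g (rot (rot d))) \<in> set [(p,q,s), (q,s,p), (s,p,q), (q,p,r), (p,r,q), (r,q,p), (r,s,q), (s,q,r), (q,r,s), (s,r,p), (r,p,s), (p,s,r)]}"
    by (intro Collect_cong conj_cong refl) (simp only: step list.set)
  then have "card {d \<in> A. c (rot d) = (c d + 1) mod 3} = (\<Sum>(a, b, c)\<leftarrow>[(p,q,s), (q,s,p), (s,p,q), (q,p,r), (p,r,q), (r,q,p), (r,s,q), (s,q,r), (q,r,s), (s,r,p), (r,p,s), (p,s,r)]. N a b c)"
    using distinct by (simp only:, intro count) simp
  also have "\<dots> = 3 * (N p q s + N q p r + N r s q + N s r p)"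
    using N_rotate[of p q s] N_rotate[of q s p] N_rotate[of q p r] N_rotate[of p r q]
      N_rotate[of r s q] N_rotate[of s q r] N_rotate[of s r p] N_rotate[of r p s]
    by simp
  finally have pos: "card {d \<in> A. c (rot d) = (c d + 1) mod 3} = 3 * (N p q s + N q p r + N r s q + N s r p)" .
  have "{d \<in> A. c (rot d) \<noteq> (c d + 1) mod 3} =
      {d \<in> A. (g d, g (rot d), g (rot (rot d))) \<in> set [(p,q,r), (q,r,p), (r,p,q), (q,p,s), (p,s,q), (s,q,p), (r,s,p), (s,p,r), (p,r,s), (s,r,q), (r,q,s), (q,s,r)]}"
    by (intro Collect_cong conj_cong refl) (simp only: step' list.set)
  then have "card {d \<in> A. c (rot d) \<noteq> (c d + 1) mod 3} = (\<Sum>(a, b, c)\<leftarrow>[(p,q,r), (q,r,p), (r,p,q), (q,p,s), (p,s,q), (s,q,p), (r,s,p), (s,p,r), (p,r,s), (s,r,q), (r,q,s), (q,s,r)]. N a b c)"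
    using distinct by (simp only:, intro count) simp
  also have "\<dots> = 3 * (N p q r + N q p s + N r s p + N s r q)"
    using N_rotate[of p q r] N_rotate[of q r p] N_rotate[of q p s] N_rotate[of p s q]
      N_rotate[of r s p] N_rotate[of s p r] N_rotate[of s r q] N_rotate[of r q s]
    by simp
  finally have neg: "card {d \<in> A. c (rot d) \<noteq> (c d + 1) mod 3} = 3 * (N p q r + N q p s + N r s p + N s r q)" .
  have edge: "int (N a b c) + int (N a b e) = int (N b a c) + int (N b a e)"
    if "UNIV = {a, b, c, e}" "distinct [a, b, c, e]" for a b c e
    using N_edge[OF that] by (simp flip: of_nat_add)
  \<comment> \<open>The edges \<open>{p, q}\<close>, \<open>{r, s}\<close> and \<open>{p, r}\<close>
    join the four faces of the tetrahedron into a tree, so the signed counts over all four faces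
    agree. With three corners per triangle this gives the factor 12.\<close>
  have "int (N p q s) + int (N p q r) = int (N q p s) + int (N q p r)"
    using UNIV distinct by (intro edge) auto
  moreover have "int (N r s q) + int (N r s p) = int (N s r q) + int (N s r p)"
    using UNIV distinct by (intro edge) auto
  moreover have "int (N p r q) + int (N p r s) = int (N r p q) + int (N r p s)"
    using UNIV distinct by (intro edge) auto
  moreover have "N p r q = N q p r" "N p r s = N r s p" "N r p q = N p q r" "N r p s = N s r p"
    using N_rotate[of p r q] N_rotate[of r q p] N_rotate[of p r s] N_rotate[of r p q] N_rotate[of s r p] by simp_all
  ultimately have "int (card {d \<in> A. c (rot d) = (c d + 1) mod 3}) - int (card {d \<in> A. c (rot d) \<noteq> (c d + 1) mod 3})
      = 12 * (int (N p q s) - int (N q p s))"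
    unfolding pos neg by simp
  then show ?thesis by (simp only: cong_iff_dvd_diff dvd_triv_left)
qed

section \<open>Medial graphs of plane cubic graphs\<close>

text \<open>The size of \<open>S\<close> cancels in the conditional probabilities. If no element of
  \<open>S\<close> satisfies \<open>Q\<close>, both sides are 0, as division by 0 yields 0.\<close>

lemma bias_pmf_of_set:
  assumes "finite S" "S \<noteq> {}"
  shows "bias (pmf_of_set S) P Q =
    (real (card {x\<in>S. Q x \<and> P x}) - real (card {x\<in>S. Q x \<and> \<not> P x})) / real (card {x\<in>S. Q x})"
proof -
  have "measure (measure_pmf (pmf_of_set S)) {x. R x} = real (card {x\<in>S. R x}) / real (card S)" for R
    using assms by (simp add: measure_pmf_of_set Int_def)
  moreover have "card S \<noteq> 0" using assms by simp
  ultimately show ?thesis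
    by (simp add: bias_def cond_prob_def diff_divide_distrib conj_commute)
qed

lemma sum_neg_one_power:
  assumes "finite A"
  shows "(\<Sum>x\<in>A. (-1) ^ f x :: 'a :: ring_1) = of_nat (card {x\<in>A. even (f x)}) - of_nat (card {x\<in>A. odd (f x)})"
proof -
  have "(\<Sum>x\<in>A. (-1) ^ f x :: 'a) = (\<Sum>x\<in>A. of_bool (even (f x)) - of_bool (odd (f x)))"
    by (intro sum.cong refl) auto
  also have "\<dots> = (\<Sum>x\<in>A. of_bool (even (f x))) - (\<Sum>x\<in>A. of_bool (odd (f x)))"
    by (rule sum_subtractf)
  finally show ?thesis
    using assms by (simp add: of_bool_def sum_if_const)
qed

text \<open>The size of an orbit is its first return time. For \<open>rot\<close> at a vertex of
  degree 3 this yields that \<open>rot\<close> has order 3 there and lists the three darts.\<close>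

lemma orbit_card_funpow:
  assumes "x \<in> orbit f x"
  shows "(f ^^ card (orbit f x)) x = x"
    and "orbit f x = (\<lambda>n. (f ^^ n) x) ` {0..<card (orbit f x)}"
proof -
  have "card (orbit f x) = funpow_dist1 f x x"
    using orbit_conv_funpow_dist1[OF assms] inj_on_funpow_dist1[OF assms] by (simp add: card_image)
  then show "(f ^^ card (orbit f x)) x = x" "orbit f x = (\<lambda>n. (f ^^ n) x) ` {0..<card (orbit f x)}"
    using funpow_dist1_prop[OF assms] orbit_conv_funpow_dist1[OF assms] by simp_all
qed

context embedded_graph
begin

text \<open>The corners that begin at \<open>edge d\<close> are \<open>d\<close> and
  \<open>arev d\<close>, and \<open>rot\<close> maps the corners that end there bijectively onto
  them.\<close>

lemma four_regular_medial_graph: "four_regular_graph (medial_graph H arev rot)"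
proof
  let ?M = "medial_graph H arev rot"
  show "finite (verts ?M)" "finite (arcs ?M)"
    by (simp_all add: medial_graph_def)
  show "tail ?M e \<in> verts ?M" "head ?M e \<in> verts ?M" if "e \<in> arcs ?M" for e
    using that by (auto simp: medial_graph_def)
  fix e assume "e \<in> verts ?M"
  then obtain d where d: "d \<in> arcs H" "e = edge d"
    by (auto simp: medial_graph_def)
  have out: "out_arcs ?M e = {d, arev d}"
    using d by (auto simp: out_arcs_def medial_graph_def edge_eq_iff)
  have "rot ` in_arcs ?M e = out_arcs ?M e"
  proof (intro equalityI subsetI)
    fix b assume "b \<in> out_arcs ?M e"
    then have b: "b \<in> arcs H" "edge b = e" by (simp_all add: medial_graph_def)
    then obtain a where "a \<in> arcs H" "b = rot a"
      using permutes_image[OF rot_permutes] by blast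
    then show "b \<in> rot ` in_arcs ?M e"
      using b by (auto simp: medial_graph_def)
  qed (auto simp: medial_graph_def)
  then have "card (in_arcs ?M e) = card (out_arcs ?M e)"
    using card_image[OF inj_on_subset[OF permutes_inj[OF rot_permutes] subset_UNIV]] by metis
  moreover have "card (out_arcs ?M e) = 2"
    unfolding out using arev_neq[OF d(1)] by simp
  ultimately show "in_degree ?M e + out_degree ?M e = 4"
    by (simp add: in_degree_def out_degree_def)
qed

lemma cubic_out_arcs:
  assumes "cubic H" "d \<in> arcs H"
  shows "rot (rot (rot d)) = d" "out_arcs H (tail H d) = {d, rot d, rot (rot d)}"
proof -
  have "card (orbit rot d) = 3"
    using assms(1) tail_in_verts[OF assms(2)] unfolding rot_out_arcs[OF assms(2), symmetric]
    by (simp add: cubic_def out_degree_def)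
  moreover have "d \<in> orbit rot d"
    unfolding rot_out_arcs[OF assms(2), symmetric] using assms(2) by simp
  ultimately show "rot (rot (rot d)) = d" "out_arcs H (tail H d) = {d, rot d, rot (rot d)}"
    using orbit_card_funpow[of d rot] rot_out_arcs[OF assms(2)]
    by (auto simp: numeral_3_eq_3 atLeast0_lessThan_Suc)
qed

end

section \<open>The contribution of each 3-edge-colouring\<close>

context plane_graph
begin

text \<open>Every colour occurs exactly once around each vertex, so for any colour the edges not of
  that colour form a mod-2 flow. The flows for the colours 0 and 1 come from face 2-colourings,
  which are the two bits of the labelling required by \<open>colour_steps_balanced\<close>.\<close>

lemma edge_colouring_steps_balanced:
  fixes x :: "'b set \<Rightarrow> nat"
  assumes cubic: "cubic H" and x: "x ` edges \<subseteq> {..<3}"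
    and proper: "\<And>d. d \<in> arcs H \<Longrightarrow> x (edge (rot d)) \<noteq> x (edge d)"
  shows "[int (card {d \<in> arcs H. x (edge (rot d)) = (x (edge d) + 1) mod 3}) =
          int (card {d \<in> arcs H. x (edge (rot d)) \<noteq> (x (edge d) + 1) mod 3})] (mod 12)"
proof -
  have no_isolated: "\<forall>v\<in>verts H. out_arcs H v \<noteq> {}"
    using cubic by (auto simp: cubic_def out_degree_def simp del: in_out_arcs_conv)
  have c: "x (edge d) < 3" if "d \<in> arcs H" for d
    using x that by auto
  have flow: "(\<lambda>e\<in>edges. x e \<noteq> k) \<in> mod2_flows" if "k < 3" for k
    unfolding mod2_flows_def
  proof (intro CollectI conjI ballI)
    fix v assume v: "v \<in> verts H"
    obtain d where d: "d \<in> arcs H" "tail H d = v"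
      using no_isolated v by (metis ex_in_conv in_out_arcs_conv)
    note out = cubic_out_arcs[OF cubic d(1), unfolded d(2)]
    have "inj_on (\<lambda>d. x (edge d)) (out_arcs H v)"
      unfolding out(2) using proper[OF d(1)] proper[of "rot d"] proper[of "rot (rot d)"] d(1)
      by (auto simp: out(1) simp del: insert_iff)
    moreover have "(\<lambda>d. x (edge d)) ` out_arcs H v \<subseteq> {..<3}"
      using c by auto
    moreover have "card (out_arcs H v) = 3"
      using cubic v by (simp add: cubic_def out_degree_def)
    ultimately have bij: "bij_betw (\<lambda>d. x (edge d)) (out_arcs H v) {..<3}"
      by (simp add: bij_betw_def card_image card_subset_eq)
    have "{d \<in> out_arcs H v. (\<lambda>e\<in>edges. x e \<noteq> k) (edge d)} = {d \<in> out_arcs H v. x (edge d) \<noteq> k}"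
      by auto
    also have "card \<dots> = card ({..<3} - {k})"
    proof -
      have "f ` {d \<in> S. f d \<noteq> k} = f ` S - {k}" for f :: "'b \<Rightarrow> nat" and S
        by auto
      then have "bij_betw (\<lambda>d. x (edge d)) {d \<in> out_arcs H v. x (edge d) \<noteq> k} ({..<3} - {k})"
        using bij by (intro bij_betw_subset[OF bij]) (auto simp only: bij_betw_def)
      then show ?thesis by (rule bij_betw_same_card)
    qed
    also have "\<dots> = 2"
      using \<open>k < 3\<close> by simp
    finally show "even (card {d \<in> out_arcs H v. (\<lambda>e\<in>edges. x e \<noteq> k) (edge d)})" by simp
  qed simp
  have flow0: "(\<lambda>e\<in>edges. x e \<noteq> 0) \<in> mod2_flows" by (rule flow) simp
  obtain g0 :: "'b \<Rightarrow> bool" where g0: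
    "\<forall>d\<in>arcs H. g0 (rot (arev d)) = g0 d"
    "\<forall>d\<in>arcs H. (\<lambda>e\<in>edges. x e \<noteq> 0) (edge d) \<longleftrightarrow> g0 d \<noteq> g0 (arev d)"
    using face_2_colouring[OF no_isolated flow0] by (elim exE conjE) (rule that)
  have flow1: "(\<lambda>e\<in>edges. x e \<noteq> 1) \<in> mod2_flows" by (rule flow) simp
  obtain g1 :: "'b \<Rightarrow> bool" where g1:
    "\<forall>d\<in>arcs H. g1 (rot (arev d)) = g1 d"
    "\<forall>d\<in>arcs H. (\<lambda>e\<in>edges. x e \<noteq> 1) (edge d) \<longleftrightarrow> g1 d \<noteq> g1 (arev d)"
    using face_2_colouring[OF no_isolated flow1] by (elim exE conjE) (rule that)
  have arev: "g0 (arev d) = g0 (rot d)" "g1 (arev d) = g1 (rot d)" if "d \<in> arcs H" for d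
    using bspec[OF g0(1), of "arev d"] bspec[OF g1(1), of "arev d"] that by simp_all
  show ?thesis
  proof (rule colour_steps_balanced[where rev = arev and g = "\<lambda>d. (g0 d, g1 d)"])
    show "finite (arcs H)" by simp
    show "bij_betw rot (arcs H) (arcs H)" "bij_betw arev (arcs H) (arcs H)"
      using permutes_imp_bij[OF rot_permutes] permutes_imp_bij[OF arev_permutes_arcs] .
  next
    fix d assume d: "d \<in> arcs H"
    show "rot (rot (rot d)) = d" by (rule cubic_out_arcs[OF cubic d])
    show "(g0 (arev d), g1 (arev d)) = (g0 (rot d), g1 (rot d))" "(g0 (rot (arev d)), g1 (rot (arev d))) = (g0 d, g1 d)"
      using arev[OF d] bspec[OF g0(1) d] bspec[OF g1(1) d] by simp_all
    show "x (edge d) < 3" "x (edge (rot d)) \<noteq> x (edge d)"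
      using c[OF d] proper[OF d] .
    show "x (edge d) \<noteq> 0 \<longleftrightarrow> fst (g0 d, g1 d) \<noteq> fst (g0 (rot d), g1 (rot d))"
      "x (edge d) \<noteq> 1 \<longleftrightarrow> snd (g0 d, g1 d) \<noteq> snd (g0 (rot d), g1 (rot d))"
      using bspec[OF g0(2) d] bspec[OF g1(2) d] arev[OF d] d by auto
  qed
qed

text \<open>Pulling \<open>\<omega> ^ x (edge d)\<close> out of the factor of the corner
  \<open>d\<close> leaves \<open>1 - \<omega>\<close> or \<open>1 - \<omega>\<^sup>2\<close>
  according to the colour step. These remainders multiply to the claimed power of 3 by
  \<open>rotation_weight\<close>.\<close>

lemma proper_edge_colouring_weight:
  fixes x :: "'b set \<Rightarrow> nat"
  assumes cubic: "cubic H" and x: "x ` edges \<subseteq> {..<3}"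
    and proper: "\<And>d. d \<in> arcs H \<Longrightarrow> x (edge (rot d)) \<noteq> x (edge d)"
  shows "(\<Prod>d\<in>arcs H. \<omega> ^ x (edge d) - \<omega> ^ x (edge (rot d))) * (\<Prod>e\<in>edges. \<omega> ^ x e) = 3 ^ card edges"
proof -
  let ?P = "\<lambda>d. x (edge (rot d)) = (x (edge d) + 1) mod 3"
  have "(\<Prod>d\<in>arcs H. \<omega> ^ x (edge d) - \<omega> ^ x (edge (rot d))) =
      (\<Prod>d\<in>arcs H. \<omega> ^ x (edge d) * (if ?P d then 1 - \<omega> else 1 - \<omega>\<^sup>2))"
  proof (intro prod.cong refl)
    fix d assume d: "d \<in> arcs H"
    have "x (edge d') < 3" if "d' \<in> arcs H" for d'
      using x that by auto
    then have "x (edge d) < 3" "x (edge (rot d)) < 3" using d by simp_all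
    moreover have "b = (a + (if b = (a + 1) mod 3 then 1 else 2)) mod 3"
      if "a < 3" "b < 3" "b \<noteq> a" for a b :: nat
    proof -
      have "a \<in> {0, 1, 2}" "b \<in> {0, 1, 2}" using that by auto
      then show ?thesis using that by auto
    qed
    ultimately have "x (edge (rot d)) = (x (edge d) + (if ?P d then 1 else 2)) mod 3"
      using proper[OF d] by blast
    then have "\<omega> ^ x (edge (rot d)) = \<omega> ^ (x (edge d) + (if ?P d then 1 else 2))"
      using \<omega>_power_mod by metis
    then show "\<omega> ^ x (edge d) - \<omega> ^ x (edge (rot d)) = \<omega> ^ x (edge d) * (if ?P d then 1 - \<omega> else 1 - \<omega>\<^sup>2)"
      by (simp add: power_add right_diff_distrib split: if_splits)
  qed
  also have "\<dots> = (\<Prod>d\<in>arcs H. \<omega> ^ x (edge d)) * (\<Prod>d\<in>arcs H. if ?P d then 1 - \<omega> else 1 - \<omega>\<^sup>2)"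
    by (rule prod.distrib)
  also have "(\<Prod>d\<in>arcs H. if ?P d then 1 - \<omega> else 1 - \<omega>\<^sup>2) =
      (1 - \<omega>) ^ card {d \<in> arcs H. ?P d} * (1 - \<omega>\<^sup>2) ^ card {d \<in> arcs H. \<not> ?P d}"
    by (subst prod.If_cases) (simp_all add: Int_def)
  also have "\<dots> = 3 ^ card edges"
  proof (rule rotation_weight)
    show "card {d \<in> arcs H. ?P d} + card {d \<in> arcs H. \<not> ?P d} = 2 * card edges"
      unfolding card_arcs_edges[symmetric] by (rule card_filter_add_card_filter_not) simp
    show "[int (card {d \<in> arcs H. ?P d}) = int (card {d \<in> arcs H. \<not> ?P d})] (mod 12)"
      using assms by (rule edge_colouring_steps_balanced)
  qed
  also have "(\<Prod>d\<in>arcs H. \<omega> ^ x (edge d)) = (\<Prod>e\<in>edges. \<Prod>d\<in>e. \<omega> ^ x (edge d))"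
    by (rule prod.edges[OF bidirected_digraph]) simp
  also have "\<dots> = (\<Prod>e\<in>edges. (\<omega> ^ x e)\<^sup>2)"
  proof (intro prod.cong refl)
    fix e assume "e \<in> edges"
    then obtain d where d: "d \<in> arcs H" "e = edge d" by blast
    show "(\<Prod>d\<in>e. \<omega> ^ x (edge d)) = (\<omega> ^ x e)\<^sup>2"
      unfolding d(2) prod.edge[OF bidirected_digraph d(1)]
      by (simp add: power2_eq_square insert_commute)
  qed
  finally have "(\<Prod>d\<in>arcs H. \<omega> ^ x (edge d) - \<omega> ^ x (edge (rot d))) * (\<Prod>e\<in>edges. \<omega> ^ x e) =
      (\<Prod>e\<in>edges. (\<omega> ^ x e)\<^sup>2) * 3 ^ card edges * (\<Prod>e\<in>edges. \<omega> ^ x e)"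
    by simp
  also have "\<dots> = 3 ^ card edges * (\<Prod>e\<in>edges. (\<omega> ^ x e)\<^sup>2 * \<omega> ^ x e)"
    by (simp add: prod.distrib mult_ac)
  \<comment> \<open>Two corners begin at each edge, so with the extra factor the colour of the edge
    enters as a cube, which is 1.\<close>
  also have "(\<Prod>e\<in>edges. (\<omega> ^ x e)\<^sup>2 * \<omega> ^ x e) = 1"
  proof (intro prod.neutral ballI)
    fix e
    have "(\<omega> ^ x e)\<^sup>2 * \<omega> ^ x e = (\<omega> ^ 3) ^ x e"
      by (simp flip: power_mult power_add add: mult.commute)
    then show "(\<omega> ^ x e)\<^sup>2 * \<omega> ^ x e = 1" by (simp add: \<omega>_cube)
  qed
  finally show ?thesis by simp
qed

text \<open>In the sum that extracts the signed count of eulerian orientations, improper colourings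
  contribute 0 and proper ones \<open>3 ^ card edges\<close>. This is the same power of 3 as in
  \<open>sum_eulerian_orientations\<close>, so it cancels.\<close>

lemma num_colourings_medial_graph:
  assumes cubic: "cubic H" and M: "M = medial_graph H arev rot"
  shows "of_nat (num_colourings M 3) =
    (\<Sum>\<alpha> | \<alpha> \<in> orientations M \<and> eulerian_orientation M \<alpha>. (-1) ^ card {e \<in> arcs M. \<not> \<alpha> e} :: complex)"
proof -
  interpret M: four_regular_graph M
    unfolding M by (rule four_regular_medial_graph)
  have M_simps: "verts M = edges" "arcs M = arcs H" "tail M d = edge d" "head M d = edge (rot d)" for d
    by (simp_all add: M medial_graph_def)
  let ?proper = "\<lambda>x :: 'b set \<Rightarrow> nat. \<forall>d\<in>arcs H. x (edge d) \<noteq> x (edge (rot d))"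
  have "(\<Sum>x\<in>edges \<rightarrow>\<^sub>E {..<3}. (\<Prod>d\<in>arcs H. \<omega> ^ x (edge d) - \<omega> ^ x (edge (rot d))) * (\<Prod>e\<in>edges. \<omega> ^ x e)) =
      (\<Sum>x\<in>edges \<rightarrow>\<^sub>E {..<3}. if ?proper x then 3 ^ card edges else 0)"
  proof (intro sum.cong refl)
    fix x :: "'b set \<Rightarrow> nat" assume x: "x \<in> edges \<rightarrow>\<^sub>E {..<3}"
    show "(\<Prod>d\<in>arcs H. \<omega> ^ x (edge d) - \<omega> ^ x (edge (rot d))) * (\<Prod>e\<in>edges. \<omega> ^ x e) =
        (if ?proper x then 3 ^ card edges else 0)"
    proof (cases "?proper x")
      case True
      have "x ` edges \<subseteq> {..<3}" using x by (auto simp: PiE_def Pi_def)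
      moreover have "x (edge (rot d)) \<noteq> x (edge d)" if "d \<in> arcs H" for d
        using True that by force
      ultimately show ?thesis
        using proper_edge_colouring_weight[OF cubic] True by simp
    next
      case False
      then obtain d where "d \<in> arcs H" "x (edge d) = x (edge (rot d))" by blast
      then have "(\<Prod>d\<in>arcs H. \<omega> ^ x (edge d) - \<omega> ^ x (edge (rot d))) = 0"
        by (intro prod_zero bexI[of _ d]) simp_all
      then show ?thesis using False by auto
    qed
  qed
  also have "\<dots> = of_nat (num_colourings M 3) * 3 ^ card edges"
    by (simp add: sum_if_const finite_PiE num_colourings_def M_simps)
  finally show ?thesis
    using M.sum_eulerian_orientations by (simp add: M_simps)
qed

end

theorem theorem5p1:
  fixes H :: "('v, 'd) pre_digraph" and arev rot :: "'d \<Rightarrow> 'd"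
    and G :: "('d set, 'd) pre_digraph" and \<gamma> :: "'d \<Rightarrow> bool"
  assumes "plane_graph H arev rot" and "cubic H"
    and "G = medial_graph H arev rot"
    and "\<gamma> = clockwise_orientation H"
  shows "bias (pmf_of_set (orientations G))
           (\<lambda>\<alpha>. even (card (agreement G \<alpha> \<gamma>)))
           (\<lambda>\<alpha>. eulerian_orientation G \<alpha>)
         = real (num_colourings G 3) / real (num_nowhere_zero_flows G 3)"
proof -
  interpret H: plane_graph H arev rot by fact
  interpret G: four_regular_graph G
    unfolding assms(3) by (rule H.four_regular_medial_graph)
  have arcs: "arcs G = arcs H"
    by (simp add: assms(3) medial_graph_def)
  have O: "finite (orientations G)" "orientations G \<noteq> {}"
    unfolding orientations_def by (auto intro!: finite_PiE simp: PiE_eq_empty_iff)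
  \<comment> \<open>As \<open>\<gamma>\<close> is \<open>True\<close> on all arcs, the edges of
    disagreement are those where \<alpha> is false. The total number of arcs is even, so agreement
    and disagreement have the same parity.\<close>
  have parity: "even (card (agreement G \<alpha> \<gamma>)) \<longleftrightarrow> even (card {e \<in> arcs G. \<not> \<alpha> e})" for \<alpha>
  proof -
    have "agreement G \<alpha> \<gamma> = {e \<in> arcs G. \<alpha> e}"
      by (auto simp: agreement_def assms(4) clockwise_orientation_def arcs)
    then have "card (agreement G \<alpha> \<gamma>) + card {e \<in> arcs G. \<not> \<alpha> e} = 2 * card H.edges"
      using card_filter_add_card_filter_not[OF G.finite_arcs, of \<alpha>] H.card_arcs_edges arcs by simp
    moreover have "even m \<longleftrightarrow> even n" if "m + n = 2 * k" for m n k :: nat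
      using that by presburger
    ultimately show ?thesis by blast
  qed
  let ?E = "{\<alpha> \<in> orientations G. eulerian_orientation G \<alpha>}"
  \<comment> \<open>The identity involves roots of unity only in its derivation; both sides are
    real, so it descends from the complex numbers.\<close>
  have "complex_of_real (real (num_colourings G 3)) =
      complex_of_real (real (card {\<alpha>\<in>?E. even (card {e \<in> arcs G. \<not> \<alpha> e})}) - real (card {\<alpha>\<in>?E. odd (card {e \<in> arcs G. \<not> \<alpha> e})}))"
    using H.num_colourings_medial_graph[OF assms(2,3)] O(1) by (simp add: sum_neg_one_power)
  then have "real (num_colourings G 3) =
      real (card {\<alpha>\<in>?E. even (card {e \<in> arcs G. \<not> \<alpha> e})}) - real (card {\<alpha>\<in>?E. odd (card {e \<in> arcs G. \<not> \<alpha> e})})"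
    by (simp only: of_real_eq_iff)
  then show ?thesis
    unfolding bias_pmf_of_set[OF O] parity G.num_nowhere_zero_flows_3 by simp
qed

end
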